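(* Let $n,m$ be positive integers and let $x\in k_m$ be such that $x^n$ is a generic element of $k_m$. Then the representation $\varphi_x:k_n^m\oplus{}^{\sigma_n}k_n^m\to k_n^m$ of $\Lambda_n$ whose matrix is $[\alpha(x)\ \ \mathrm{id}_m]$ is a regular simple representation.
   Context: $k=\mathbb{C}(\!(\varepsilon)\!)$, $k_n=\mathbb{C}(\!(\varepsilon^{1/n})\!)$ and $\sigma_n$ is the $k$-automorphism of $k_n$ with $\sigma_n(\varepsilon^{j/n})=\zeta_n^j\varepsilon^{j/n}$, $\zeta_n=e^{2\pi i/n}$. An element $y\in k_m$ is generic if its orbit under $\langle\sigma_m\rangle$ has exactly $m$ elements. $\alpha_m\in\mathrm{Mat}_{m\times m}(k)$ is the matrix with $(\alpha_m)_{ij}=\delta_{i+1,j}$ for $i<m$ and $(\alpha_m)_{mj}=\delta_{1,j}\varepsilon$ (so $\alpha_1=\varepsilon$); its minimal polynomial is $y^m-\varepsilon$. The map $\alpha:k_m\to\mathrm{Mat}_{m\times m}(k)$ is the $k$-algebra homomorphism sending $\varepsilon^{1/m}$ to $\alpha_m$, i.e. $\alpha(\sum_{i=0}^{m-1}x_i\varepsilon^{i/m})=\sum_i x_i\alpha_m^i$ for $x_i\in k$. ${}^{\sigma_n}k_n$ is the $k_n$-$k_n$-bimodule $k_n$ with usual right action and left action $y*x=\sigma_n(y)x$, and $\Lambda_n=\begin{bmatrix} k_n & k_n\oplus{}^{\sigma_n}k_n\\ 0 & k_n\end{bmatrix}$. A representation of $\Lambda_n$ is a triple $(k_n^{p},k_n^{p'},\varphi)$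 with $\varphi:(k_n\oplus{}^{\sigma_n}k_n)\otimes_{k_n}k_n^{p'}=k_n^{p'}\oplus{}^{\sigma_n}k_n^{p'}\to k_n^p$ left $k_n$-linear. Its matrix $[A\ B]$ (with $A,B\in\mathrm{Mat}_{p\times p'}(k_n)$) has as columns the images of the standard basis vectors of the two summands; thus $\varphi(v,w)=Av+B\sigma_n^{-1}(w)$ with $\sigma_n^{-1}$ applied entrywise. Its dimension vector is $(p',p)$. Morphisms from $[A\ B]$ to $[A'\ B']$ are pairs $(P,Q)$ of matrices over $k_n$ with $QA=A'P$ and $QB=B'\sigma_n^{-1}(P)$. A representation is regular simple if its dimension vector is $(p,p)$ for some $p\ge1$ and its endomorphism ring is a division algebra. *)

theory Defs
  imports
    "HOL-Computational_Algebra.Formal_Laurent_Series"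
    "Jordan_Normal_Form.VS_Connect"
    Complex_Main
begin

text \<open>
  Every field k_n = C((eps^(1/n))) is represented by the type of formal Laurent series over
  the complex numbers, the formal variable standing for eps^(1/n). Hence the same type serves for
  all k_n and for k = k_1, and the inclusion of k into k_n is the substitution of the n-th power
  of the variable for the variable.
\<close>

type_synonym laurent = "complex fls"

definition incl :: "nat \<Rightarrow> laurent \<Rightarrow> laurent" where
  "incl n f = fls_compose_power f n"

definition zeta :: "nat \<Rightarrow> complex" where
  "zeta n = cis (2 * pi / of_nat n)"

lift_definition sigma :: "nat \<Rightarrow> laurent \<Rightarrow> laurent" is
  "\<lambda>n f j. zeta n powi j * f j"
  by (auto elim: eventually_mono)

definition sigma_inv :: "nat \<Rightarrow> laurent \<Rightarrow> laurent" where
  "sigma_inv n = inv_into UNIV (sigma n)"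

text \<open>
  The orbit is written with natural powers only; since sigma m has finite order
  (lemma \<open>sigma_order\<close> below), these are all the elements of the group it generates.
\<close>

definition generic :: "nat \<Rightarrow> laurent \<Rightarrow> bool" where
  "generic m y \<longleftrightarrow> card (range (\<lambda>j. (sigma m ^^ j) y)) = m"

text \<open>Matrix indices start at 0.\<close>

definition alpha_gen :: "nat \<Rightarrow> laurent mat" where
  "alpha_gen m = mat m m (\<lambda>(i, j).
     if i + 1 < m then (if j = i + 1 then 1 else 0)
     else (if j = 0 then fls_X else 0))"

text \<open>
  \<open>component m i x\<close> is the coefficient x_i in k of the expansion of x in k_m with respect to the
  k-basis eps^(i/m), i < m, of k_m; see lemma \<open>component_expansion\<close>.
\<close>

lift_definition component :: "nat \<Rightarrow> nat \<Rightarrow> laurent \<Rightarrow> laurent" is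
  "\<lambda>m i f j. if m = 0 then 0 else f (int m * j + int i)"
proof -
  fix m i :: nat and f :: "int \<Rightarrow> complex"
  assume "\<forall>\<^sub>\<infinity>n. f (- int n) = 0"
  then obtain N where N: "\<And>n. n \<ge> N \<Longrightarrow> f (- int n) = 0"
    by (auto simp: MOST_nat_le)
  show "\<forall>\<^sub>\<infinity>n. (if m = 0 then 0 else f (int m * - int n + int i)) = 0"
    unfolding MOST_nat_le
  proof (intro exI allI impI)
    fix n assume n: "n \<ge> N + i"
    show "(if m = 0 then 0 else f (int m * - int n + int i)) = 0"
    proof (cases "m = 0")
      case False
      then have "m * n \<ge> N + i"
        using n by (metis le_trans mult_le_mono1 nat_mult_1 One_nat_def Suc_leI neq0_conv)
      then have "int m * - int n + int i = - int (m * n - i)" and "m * n - i \<ge> N"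
        by (auto simp: of_nat_diff)
      then show ?thesis using N[of "m * n - i"] by simp
    qed simp
  qed
qed

definition alpha :: "nat \<Rightarrow> laurent \<Rightarrow> laurent mat" where
  "alpha m x = mat m m (\<lambda>rc. \<Sum>i<m. component m i x * (alpha_gen m ^\<^sub>m i) $$ rc)"

text \<open>
  A representation of Lambda_n is encoded as \<open>(p, p', \<phi>)\<close>, where \<open>\<phi>\<close> maps the k_n-vector
  spaces k_n^p' + ^sigma k_n^p' to k_n^p. In the second summand the scalar c acts as sigma(c).
\<close>

type_synonym rep = "nat \<times> nat \<times> (laurent vec \<Rightarrow> laurent vec \<Rightarrow> laurent vec)"

fun is_representation :: "nat \<Rightarrow> rep \<Rightarrow> bool" where
  "is_representation n (p, p', \<phi>) \<longleftrightarrow>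
     (\<forall>v \<in> carrier_vec p'. \<forall>w \<in> carrier_vec p'. \<phi> v w \<in> carrier_vec p) \<and>
     (\<forall>v \<in> carrier_vec p'. \<forall>w \<in> carrier_vec p'. \<forall>v' \<in> carrier_vec p'. \<forall>w' \<in> carrier_vec p'.
        \<phi> (v + v') (w + w') = \<phi> v w + \<phi> v' w') \<and>
     (\<forall>c. \<forall>v \<in> carrier_vec p'. \<forall>w \<in> carrier_vec p'.
        \<phi> (c \<cdot>\<^sub>v v) (sigma n c \<cdot>\<^sub>v w) = c \<cdot>\<^sub>v \<phi> v w)"

fun dimension_vector :: "rep \<Rightarrow> nat \<times> nat" where
  "dimension_vector (p, p', \<phi>) = (p', p)"

fun rep_matrix :: "rep \<Rightarrow> laurent mat \<times> laurent mat" where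
  "rep_matrix (p, p', \<phi>) =
     (mat p p' (\<lambda>(i, j). \<phi> (unit_vec p' j) (0\<^sub>v p') $ i),
      mat p p' (\<lambda>(i, j). \<phi> (0\<^sub>v p') (unit_vec p' j) $ i))"

text \<open>The representation with matrix [A B]; see lemma \<open>rep_matrix_rep_of\<close>.\<close>

definition rep_of :: "nat \<Rightarrow> laurent mat \<Rightarrow> laurent mat \<Rightarrow> rep" where
  "rep_of n A B =
     (dim_row A, dim_col A, \<lambda>v w. A *\<^sub>v v + B *\<^sub>v map_vec (sigma_inv n) w)"

definition rep_hom :: "nat \<Rightarrow> rep \<Rightarrow> rep \<Rightarrow> (laurent mat \<times> laurent mat) set" where
  "rep_hom n M M' =
     (let (A, B) = rep_matrix M; (A', B') = rep_matrix M';
          (p', p) = dimension_vector M; (q', q) = dimension_vector M'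
      in {(P, Q). P \<in> carrier_mat q' p' \<and> Q \<in> carrier_mat q p \<and>
                  Q * A = A' * P \<and> Q * B = B' * map_mat (sigma_inv n) P})"

text \<open>The endomorphism ring, with its k-algebra structure.\<close>

definition endomorphism_algebra ::
  "nat \<Rightarrow> rep \<Rightarrow> (laurent, laurent mat \<times> laurent mat) module" where
  "endomorphism_algebra n M = (let (p', p) = dimension_vector M in
     \<lparr> carrier = rep_hom n M M,
       monoid.mult = (\<lambda>(P, Q) (P', Q'). (P * P', Q * Q')),
       one = (1\<^sub>m p', 1\<^sub>m p),
       zero = (0\<^sub>m p' p', 0\<^sub>m p p),
       add = (\<lambda>(P, Q) (P', Q'). (P + P', Q + Q')),
       module.smult = (\<lambda>c (P, Q). (incl n c \<cdot>\<^sub>m P, incl n c \<cdot>\<^sub>m Q)) \<rparr>)"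

definition division_algebra ::
  "('a, 'r) ring_scheme \<Rightarrow> ('a, 'b, 's) module_scheme \<Rightarrow> bool" where
  "division_algebra K E \<longleftrightarrow> Ring.field K \<and> Module.module K E \<and> Ring.ring E \<and>
     (\<forall>c \<in> carrier K. \<forall>x \<in> carrier E. \<forall>y \<in> carrier E.
        (c \<odot>\<^bsub>E\<^esub> x) \<otimes>\<^bsub>E\<^esub> y = c \<odot>\<^bsub>E\<^esub> (x \<otimes>\<^bsub>E\<^esub> y) \<and>
        x \<otimes>\<^bsub>E\<^esub> (c \<odot>\<^bsub>E\<^esub> y) = c \<odot>\<^bsub>E\<^esub> (x \<otimes>\<^bsub>E\<^esub> y)) \<and>
     Units E = carrier E - {\<zero>\<^bsub>E\<^esub>}"

definition regular_simple :: "nat \<Rightarrow> rep \<Rightarrow> bool" where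
  "regular_simple n M \<longleftrightarrow> is_representation n M \<and>
     (\<exists>p\<ge>1. dimension_vector M = (p, p)) \<and>
     division_algebra (class_ring :: laurent ring) (endomorphism_algebra n M)"


lemma zeta_power [simp]: "n > 0 \<Longrightarrow> zeta n ^ n = 1"
  by (simp add: zeta_def DeMoivre)

lemma sigma_nth [simp]: "fls_nth (sigma n f) j = zeta n powi j * fls_nth f j"
  by transfer simp

lemma sigma_funpow_nth: "fls_nth ((sigma n ^^ k) f) j = (zeta n powi j) ^ k * fls_nth f j"
  by (induction k) (auto simp: mult_ac)

lemma sigma_order: "n > 0 \<Longrightarrow> (sigma n ^^ n) = id"
proof (rule ext, rule fls_eqI)
  fix f j assume n: "n > 0"
  have "(zeta n powi j) ^ n = (zeta n ^ n) powi j"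
    by (simp add: power_int_power power_int_power' mult.commute)
  then show "fls_nth ((sigma n ^^ n) f) j = fls_nth (id f) j"
    using n by (simp add: sigma_funpow_nth)
qed

lemma zeta_nonzero [simp]: "zeta n \<noteq> 0"
  by (simp add: zeta_def)

lemma sigma_bij: "bij (sigma n)"
proof (rule bijI)
  show "inj (sigma n)"
  proof (intro injI fls_eqI)
    fix f g j assume "sigma n f = sigma n g"
    then have "fls_nth (sigma n f) j = fls_nth (sigma n g) j" by simp
    then show "fls_nth f j = fls_nth g j" by simp
  qed
  have "\<exists>g. sigma n g = f" for f
  proof -
    have "\<forall>\<^sub>\<infinity>k. fls_nth f (- int k) = 0"
      using fls_nth[of f] by simp
    then have "\<forall>\<^sub>\<infinity>k. fls_nth f (- int k) / zeta n powi (- int k) = 0"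
      by (rule eventually_mono) simp
    then have "sigma n (Abs_fls (\<lambda>j. fls_nth f j / zeta n powi j)) = f"
      by (intro fls_eqI) (simp add: Abs_fls_inverse)
    then show ?thesis by blast
  qed
  then show "surj (sigma n)" unfolding surj_def by metis
qed

lemma component_expansion:
  assumes "m > 0"
  shows "x = (\<Sum>i<m. incl m (component m i x) * fls_X ^ i)"
proof (rule fls_eqI)
  fix j :: int
  have *: "fls_nth (incl m (component m i x) * fls_X ^ i) j
      = (if i = nat (j mod int m) then fls_nth x j else 0)" if "i < m" for i
  proof -
    have "int m dvd j - int i \<longleftrightarrow> int i = j mod int m"
      using that by (auto simp: mod_eq_dvd_iff [symmetric])
    moreover have "int i = j mod int m \<longleftrightarrow> i = nat (j mod int m)"
      using assms by auto
    ultimately show ?thesis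
      using assms
      by (auto simp: incl_def fls_nth_compose_power component.rep_eq
          fls_X_power_times_conv_shift)
  qed
  have "nat (j mod int m) < m" using assms by (simp add: nat_less_iff)
  moreover have "fls_nth (\<Sum>i<m. incl m (component m i x) * fls_X ^ i) j
      = (\<Sum>i<m. if i = nat (j mod int m) then fls_nth x j else 0)"
    unfolding fls_nth_sum by (rule sum.cong) (simp_all only: * lessThan_iff)
  ultimately show "fls_nth x j = fls_nth (\<Sum>i<m. incl m (component m i x) * fls_X ^ i) j"
    by simp
qed

lemma rep_matrix_rep_of:
  assumes A: "A \<in> carrier_mat p p'" and B: "B \<in> carrier_mat p p'"
  shows "rep_matrix (rep_of n A B) = (A, B)"
proof -
  have 0: "sigma_inv n 0 = 0" and 1: "sigma_inv n 1 = 1"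
    unfolding sigma_inv_def
    by (rule inv_f_eq[OF bij_is_inj[OF sigma_bij]], rule fls_eqI, simp)+
  have z: "map_vec (sigma_inv n) (0\<^sub>v p') = 0\<^sub>v p'"
    by (rule eq_vecI) (auto simp: 0)
  have u: "map_vec (sigma_inv n) (unit_vec p' j) = unit_vec p' j" for j
    by (rule eq_vecI) (auto simp: 0 1 unit_vec_def)
  have "A *\<^sub>v 0\<^sub>v p' = 0\<^sub>v p" "B *\<^sub>v 0\<^sub>v p' = 0\<^sub>v p" using A B by auto
  then show ?thesis using A B
    by (auto simp: rep_of_def z u intro!: eq_matI)
qed

end

theory Submission
  imports Defs
begin

text \<open>
  Since the second block of the matrix is the identity, an endomorphism is determined by its first
  component \<open>P\<close>, subject to the single condition \<open>\<sigma>\<^sub>n\<^sup>-\<^sup>1(P) A = A P\<close>, where \<open>A = \<alpha>(x)\<close> has entries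
  in \<open>k\<close>. The pairs of such matrices form a \<open>k\<close>-algebra for every square matrix \<open>A\<close>, and the inverse
  of an invertible solution is again a solution; so the whole question is whether a nonzero solution
  is an invertible matrix (\<open>regular_simple_rep_of_identity\<close>).

  Expand \<open>P = \<Sum> P\<^sub>l \<epsilon>\<^bsup>l/n\<^esup>\<close> with \<open>P\<^sub>l\<close> over \<open>k\<close>. As \<open>\<sigma>\<^sub>n\<close> scales each power of \<open>\<epsilon>\<^bsup>1/n\<^esup>\<close> by a root of unity
  and fixes \<open>k\<close>, the condition separates into \<open>c P\<^sub>l A = A P\<^sub>l\<close> with \<open>c = \<zeta>\<^sub>n\<^bsup>-l\<^esup>\<close>. Read \<open>P\<^sub>l\<close> as the
  matrix of a \<open>k\<close>-linear map \<open>L\<close> of \<open>k\<^sub>m\<close> in the basis \<open>\<epsilon>\<^bsup>i/m\<^esup>\<close>, so that \<open>A\<close> is multiplication by \<open>x\<close>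
  and the condition reads \<open>L(x y) = c x L(y)\<close>. Every \<open>k\<close>-linear map of \<open>k\<^sub>m\<close> is uniquely a combination
  \<open>\<Sum> d\<^sub>j \<sigma>\<^sub>m\<^sup>j\<close> with \<open>d\<^sub>j\<close> in \<open>k\<^sub>m\<close>: on the basis \<open>\<epsilon>\<^bsup>i/m\<^esup>\<close> this is Fourier inversion over the cyclic group
  of order \<open>m\<close>. Comparing coefficients gives \<open>d\<^sub>j (\<sigma>\<^sub>m\<^sup>j(x) - c x) = 0\<close>. If \<open>d\<^sub>j\<close> is nonzero, then taking
  \<open>n\<close>-th powers removes \<open>c\<close> and leaves \<open>\<sigma>\<^sub>m\<^sup>j(x\<^sup>n) = x\<^sup>n\<close>, which for \<open>0 < j < m\<close> contradicts genericity.
  Hence \<open>L\<close> is multiplication by \<open>d\<^sub>0\<close>, and \<open>d\<^sub>0 = 0\<close> if \<open>c \<noteq> 1\<close> and \<open>x \<noteq> 0\<close>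
  (\<open>twisted_commutant\<close>).

  For \<open>x \<noteq> 0\<close> only \<open>l = 0\<close> survives, so \<open>P = \<alpha>(e)\<close> for some \<open>e\<close> in \<open>k\<^sub>m\<close>; if \<open>P\<close> is nonzero then so is \<open>e\<close>, and
  \<open>\<alpha>(1/e)\<close> is the inverse. The endomorphism algebra is thus \<open>k\<^sub>m\<close>. For \<open>x = 0\<close> genericity forces
  \<open>m = 1\<close>, and the nonzero one by one matrices are invertible.
\<close>

section \<open>The automorphism and the coordinates of a Laurent series\<close>

lemma sigma_add: "sigma n (f + g) = sigma n f + sigma n g"
  by (rule fls_eqI) (simp add: algebra_simps)

lemma sigma_const [simp]: "sigma n (fls_const c) = fls_const c"
  by (rule fls_eqI) simp

lemma fls_const_eq_1: "fls_const (c :: complex) = 1 \<longleftrightarrow> c = 1"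
  by (metis fls_const_1 fls_const_nth)

lemma subdegree_sigma: "fls_subdegree (sigma n f) = fls_subdegree f"
proof (cases "f = 0")
  case True
  then have "sigma n f = 0" by (intro fls_eqI) simp
  with True show ?thesis by simp
next
  case False
  then show ?thesis by (intro fls_subdegree_eqI) auto
qed

lemma sigma_mult: "sigma n (f * g) = sigma n f * sigma n g"
proof (rule fls_eqI)
  fix j
  let ?d = "fls_subdegree g"
  have "zeta n powi j = zeta n powi (i - ?d) * zeta n powi (?d + j - i)" for i
    by (simp flip: power_int_add)
  then show "fls_nth (sigma n (f * g)) j = fls_nth (sigma n f * sigma n g) j"
    by (simp add: fls_times_nth(1) subdegree_sigma sum_distrib_left mult_ac)
qed

lemma sigma_funpow_add: "(sigma n ^^ k) (f + g) = (sigma n ^^ k) f + (sigma n ^^ k) g"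
  by (induction k) (auto simp: sigma_add)

lemma sigma_funpow_mult: "(sigma n ^^ k) (f * g) = (sigma n ^^ k) f * (sigma n ^^ k) g"
  by (induction k) (auto simp: sigma_mult)

lemma sigma_funpow_const: "(sigma n ^^ k) (fls_const c) = fls_const c"
  by (induction k) auto

lemma sigma_funpow_sum: "(sigma n ^^ k) (sum f S) = (\<Sum>i\<in>S. (sigma n ^^ k) (f i))"
proof (induction S rule: infinite_finite_induct)
  case (insert x S)
  then show ?case by (simp add: sigma_funpow_add)
qed (use sigma_funpow_const[of k n 0] in simp_all)

lemma sigma_funpow_power: "(sigma n ^^ k) (f ^ l) = (sigma n ^^ k) f ^ l"
proof (induction l)
  case 0
  then show ?case using sigma_funpow_const[of k n 1] by simp
qed (simp add: sigma_funpow_mult)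

lemma zeta_powi_period:
  assumes "n > 0"
  shows "zeta n powi (int n * j + i) = zeta n powi i"
proof -
  have "zeta n powi (int n * j) = (zeta n ^ n) powi j"
    by (simp add: power_int_mult)
  then show ?thesis using assms by (simp add: power_int_add)
qed

lemma sigma_incl: "n > 0 \<Longrightarrow> sigma n (incl n a) = incl n a"
  using zeta_powi_period[of n _ 0]
  by (intro fls_eqI) (auto simp: incl_def fls_nth_compose_power elim!: dvdE)

lemma sigma_funpow_incl: "n > 0 \<Longrightarrow> (sigma n ^^ k) (incl n a) = incl n a"
  by (induction k) (auto simp: sigma_incl)

lemma sigma_funpow_X: "(sigma m ^^ j) fls_X = fls_const (zeta m ^ j) * fls_X"
  by (rule fls_eqI) (auto simp: sigma_funpow_nth)

lemma sigma_sigma_inv [simp]: "sigma n (sigma_inv n f) = f"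
  unfolding sigma_inv_def by (rule surj_f_inv_f[OF bij_is_surj[OF sigma_bij]])

lemma sigma_inv_sigma [simp]: "sigma_inv n (sigma n f) = f"
  unfolding sigma_inv_def by (rule inv_f_f[OF bij_is_inj[OF sigma_bij]])

lemma sigma_inv_eqI: "sigma n g = f \<Longrightarrow> sigma_inv n f = g"
  by auto

lemma sigma_inv_add: "sigma_inv n (f + g) = sigma_inv n f + sigma_inv n g"
  by (rule sigma_inv_eqI) (simp add: sigma_add)

lemma sigma_inv_mult: "sigma_inv n (f * g) = sigma_inv n f * sigma_inv n g"
  by (rule sigma_inv_eqI) (simp add: sigma_mult)

lemma sigma_inv_const [simp]: "sigma_inv n (fls_const c) = fls_const c"
  by (rule sigma_inv_eqI) simp

interpretation sigma_inv: comm_ring_hom "sigma_inv n"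
proof
  show "sigma_inv n 0 = 0" "sigma_inv n 1 = 1"
    using sigma_inv_const[of n 0] sigma_inv_const[of n 1] by simp_all
qed (simp_all add: sigma_inv_add sigma_inv_mult)

lemma sigma_inv_incl: "n > 0 \<Longrightarrow> sigma_inv n (incl n a) = incl n a"
  by (rule sigma_inv_eqI) (rule sigma_incl)

lemma sigma_inv_nth: "fls_nth (sigma_inv n f) j = inverse (zeta n powi j) * fls_nth f j"
proof -
  have "fls_nth f j = zeta n powi j * fls_nth (sigma_inv n f) j"
    by (metis sigma_nth sigma_sigma_inv)
  then show ?thesis by (simp add: field_simps)
qed

lemma incl_ring_hom:
  assumes "n > 0"
  shows "comm_ring_hom (incl n)"
  using assms by unfold_locales (simp_all add: incl_def)

lemma incl_sum: "n > 0 \<Longrightarrow> incl n (sum f S) = (\<Sum>i\<in>S. incl n (f i))"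
  by (induction S rule: infinite_finite_induct) (simp_all add: incl_def)

lemma incl_X: "n > 0 \<Longrightarrow> incl n fls_X = fls_X ^ n"
  by (simp add: incl_def fls_X_intpow_power flip: fls_X_power_conv_shift_1)

lemma component_zero [simp]: "component n i 0 = 0"
  by (rule fls_eqI) (simp add: component.rep_eq)

lemma component_add: "component n i (f + g) = component n i f + component n i g"
  by (rule fls_eqI) (simp add: component.rep_eq)

lemma component_sum: "component n i (sum f S) = (\<Sum>s\<in>S. component n i (f s))"
  by (induction S rule: infinite_finite_induct) (simp_all add: component_add)

lemma component_monomial:
  assumes "l < n" "i < n"
  shows "component n l (incl n a * fls_X ^ i) = (if i = l then a else 0)"
proof (rule fls_eqI)
  fix j
  have "int n dvd int n * j + int l - int i \<longleftrightarrow> int l mod int n = int i mod int n"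
    by (metis (no_types, opaque_lifting) add_diff_eq dvd_add_right_iff dvd_triv_left mod_eq_dvd_iff)
  then have "int n dvd int n * j + int l - int i \<longleftrightarrow> i = l"
    using assms by auto
  then show "fls_nth (component n l (incl n a * fls_X ^ i)) j =
      fls_nth (if i = l then a else 0) j"
    using assms
    by (auto simp: component.rep_eq incl_def fls_nth_compose_power
        fls_X_power_times_conv_shift)
qed

text \<open>Coordinates with respect to the powers of the variable are unique; with
  \<open>component_expansion\<close>, these powers form a basis over the smaller field.\<close>

lemma component_of_expansion:
  assumes "l < n"
  shows "component n l (\<Sum>i<n. incl n (a i) * fls_X ^ i) = a l"
  using assms by (simp add: component_sum component_monomial)

text \<open>The coordinates are linear over the smaller field, because multiplying an expansion by a
  scalar again yields an expansion.\<close>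

lemma component_incl_mult:
  assumes "l < n"
  shows "component n l (incl n a * f) = a * component n l f" (is ?left)
    and "component n l (f * incl n a) = a * component n l f"
proof -
  have "n > 0" using assms by simp
  then have "incl n a * f = (\<Sum>i<n. incl n (a * component n i f) * fls_X ^ i)"
    by (subst component_expansion[of n f]) (simp_all add: sum_distrib_left incl_def mult_ac)
  then show ?left using component_of_expansion[OF assms] by simp
  then show "component n l (f * incl n a) = a * component n l f" by (simp add: mult.commute)
qed

text \<open>This is how the semilinear condition on an endomorphism turns into linear conditions
  on its coordinate matrices: the automorphism acts diagonally on the coordinates.\<close>

lemma component_sigma_inv:
  assumes "n > 0"
  shows "component n l (sigma_inv n f) = fls_const (inverse (zeta n ^ l)) * component n l f"
  using assms
  by (intro fls_eqI) (simp add: component.rep_eq sigma_inv_nth zeta_powi_period)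

lemma zeta_power_neq_1:
  assumes "0 < l" "l < n"
  shows "zeta n ^ l \<noteq> 1"
proof
  assume 1: "zeta n ^ l = 1"
  have "inj_on (\<lambda>k. cis (2 * pi * real k / real n)) {..<n}"
    using bij_betw_roots_unity[of n] assms by (simp add: bij_betw_def)
  moreover have "cis (2 * pi * real l / real n) = cis (2 * pi * real 0 / real n)"
    using 1 by (simp add: zeta_def DeMoivre mult_ac)
  ultimately have "l = 0" by (rule inj_onD) (use assms in auto)
  with assms show False by simp
qed

text \<open>An element fixed by the \<open>j\<close>-th power of the automorphism has at most \<open>j\<close> conjugates.\<close>

lemma generic_conjugate_neq:
  assumes "generic m y" "0 < j" "j < m"
  shows "(sigma m ^^ j) y \<noteq> y"
proof
  assume fixed: "(sigma m ^^ j) y = y"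
  have "(sigma m ^^ k) y \<in> (\<lambda>i. (sigma m ^^ i) y) ` {..<j}" for k
    using funpow_mod_eq[OF fixed, of k] assms(2)
    by (intro image_eqI[of _ _ "k mod j"]) auto
  then have "card (range (\<lambda>k. (sigma m ^^ k) y)) \<le> card ((\<lambda>i. (sigma m ^^ i) y) ` {..<j})"
    by (intro card_mono) auto
  also have "\<dots> \<le> j" using card_image_le[of "{..<j}"] by simp
  finally show False using assms by (simp add: generic_def)
qed

section \<open>Fourier inversion over a cyclic group\<close>

text \<open>The sum is geometric, with a ratio that is an \<open>m\<close>-th root of unity.\<close>

lemma root_of_unity_orthogonality:
  fixes w :: "'a::field"
  assumes "w ^ m = 1" and prim: "\<And>l. 0 < l \<Longrightarrow> l < m \<Longrightarrow> w ^ l \<noteq> 1" and "i < m" "k < m"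
  shows "(\<Sum>j<m. w ^ (i * j) / w ^ (k * j)) = (if i = k then of_nat m else 0)"
proof -
  have w: "w \<noteq> 0" using assms by (auto simp: power_0_left)
  have q: "w ^ (i * j) / w ^ (k * j) = (w ^ i / w ^ k) ^ j" for j
    by (simp add: power_divide power_mult)
  show ?thesis
  proof (cases "i = k")
    case True
    then show ?thesis using w by simp
  next
    case False
    have "w ^ i \<noteq> w ^ k"
    proof (cases "i < k")
      case True
      then have "w ^ k = w ^ i * w ^ (k - i)" by (simp flip: power_add)
      then show ?thesis using prim[of "k - i"] True assms(4) w by auto
    next
      case F: False
      then have "w ^ i = w ^ k * w ^ (i - k)" by (simp flip: power_add)
      then show ?thesis using prim[of "i - k"] F False assms(3) w by auto
    qed
    define r where "r = w ^ i / w ^ k"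
    have "r \<noteq> 1" using \<open>w ^ i \<noteq> w ^ k\<close> w by (simp add: r_def)
    moreover have "r ^ m = 1"
      unfolding r_def using assms(1) by (metis div_by_1 power_divide power_mult mult.commute power_one)
    ultimately show ?thesis using False
      by (simp add: q sum_gp_strict flip: r_def)
  qed
qed

text \<open>Existence and uniqueness of the coefficients amount to the invertibility of the matrix of
  powers of a primitive root of unity. By orthogonality its inverse is \<open>1/m\<close> times the matrix of
  inverse powers, and this is where the witness comes from.\<close>

lemma fourier_synthesis_exists:
  fixes w :: "'a::field_char_0"
  assumes "w ^ m = 1" and prim: "\<And>l. 0 < l \<Longrightarrow> l < m \<Longrightarrow> w ^ l \<noteq> 1"
  shows "\<exists>c. \<forall>i<m. u i = (\<Sum>j<m. c j * w ^ (i * j))"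
proof (intro exI allI impI)
  fix i assume i: "i < m"
  have "(\<Sum>j<m. (\<Sum>k<m. u k / w ^ (k * j)) / of_nat m * w ^ (i * j))
      = (\<Sum>j<m. \<Sum>k<m. u k / of_nat m * (w ^ (i * j) / w ^ (k * j)))"
    unfolding sum_divide_distrib sum_distrib_right by (simp add: mult_ac)
  also have "\<dots> = (\<Sum>k<m. u k / of_nat m * (\<Sum>j<m. w ^ (i * j) / w ^ (k * j)))"
    by (subst sum.swap) (simp only: sum_distrib_left)
  also have "\<dots> = (\<Sum>k<m. if i = k then u k else 0)"
    using i by (intro sum.cong refl)
      (simp add: root_of_unity_orthogonality[OF assms])
  also have "\<dots> = u i" using i by simp
  finally show "u i = (\<Sum>j<m. (\<Sum>k<m. u k / w ^ (k * j)) / of_nat m * w ^ (i * j))" ..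
qed

lemma fourier_coefficients_unique:
  fixes w :: "'a::field_char_0"
  assumes "w ^ m = 1" and prim: "\<And>l. 0 < l \<Longrightarrow> l < m \<Longrightarrow> w ^ l \<noteq> 1"
    and zero: "\<And>i. i < m \<Longrightarrow> (\<Sum>j<m. d j * w ^ (i * j)) = 0" and k: "k < m"
  shows "d k = 0"
proof -
  have "0 = (\<Sum>i<m. (\<Sum>j<m. d j * w ^ (i * j)) / w ^ (k * i))"
    using zero by simp
  also have "\<dots> = (\<Sum>j<m. d j * (\<Sum>i<m. w ^ (j * i) / w ^ (k * i)))"
    unfolding sum_divide_distrib sum_distrib_left
    by (subst sum.swap) (simp add: mult.commute)
  also have "\<dots> = (\<Sum>j<m. if j = k then d j * of_nat m else 0)"
    using k by (intro sum.cong refl) (simp add: root_of_unity_orthogonality[OF assms(1,2)])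
  also have "\<dots> = d k * of_nat m" using k by simp
  finally show ?thesis using k by simp
qed

section \<open>Matrices of multiplication maps\<close>

text \<open>
  Row \<open>i\<close> of \<open>M\<close> holds the coordinates of \<open>y \<epsilon>\<^bsup>i/m\<^esup>\<close>; equivalently, the column of basis elements
  is an eigenvector of \<open>M\<close> with eigenvalue \<open>y\<close>. Row coordinates, and not the usual column
  coordinates, match the shape of the generator \<open>\<alpha>\<^sub>m\<close>. Working with this relation instead of the
  formula for \<open>\<alpha>\<close> makes multiplicativity immediate.
\<close>

definition acts_as_mult :: "nat \<Rightarrow> laurent mat \<Rightarrow> laurent \<Rightarrow> bool" where
  "acts_as_mult m M y \<longleftrightarrow> M \<in> carrier_mat m m \<and>
     (\<forall>i<m. (\<Sum>j<m. incl m (M $$ (i, j)) * fls_X ^ j) = y * fls_X ^ i)"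

lemma acts_as_mult_unique:
  assumes "acts_as_mult m M y" "acts_as_mult m N y"
  shows "M = N"
proof (rule eq_matI)
  fix i j assume "i < dim_row N" "j < dim_col N"
  then have ij: "i < m" "j < m" using assms by (auto simp: acts_as_mult_def)
  then have "(\<Sum>j<m. incl m (M $$ (i, j)) * fls_X ^ j) = (\<Sum>j<m. incl m (N $$ (i, j)) * fls_X ^ j)"
    using assms by (simp add: acts_as_mult_def)
  then show "M $$ (i, j) = N $$ (i, j)"
    using component_of_expansion[OF ij(2), of "\<lambda>j. M $$ (i, j)"]
      component_of_expansion[OF ij(2), of "\<lambda>j. N $$ (i, j)"] by simp
qed (use assms in \<open>auto simp: acts_as_mult_def\<close>)

lemma acts_as_mult_one: "m > 0 \<Longrightarrow> acts_as_mult m (1\<^sub>m m) 1"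
proof -
  assume "m > 0"
  then have "incl m (if b then 1 else 0) * z = (if b then z else 0)" for b z
    by (simp add: incl_def)
  then show ?thesis by (simp add: acts_as_mult_def)
qed

text \<open>Applying both matrices to the common eigenvector multiplies the eigenvalues.\<close>

lemma acts_as_mult_mult:
  assumes "m > 0" "acts_as_mult m M y" "acts_as_mult m N z"
  shows "acts_as_mult m (M * N) (y * z)"
proof -
  interpret incl: comm_ring_hom "incl m" by (rule incl_ring_hom[OF assms(1)])
  have c: "M \<in> carrier_mat m m" "N \<in> carrier_mat m m" using assms by (auto simp: acts_as_mult_def)
  have "(\<Sum>k<m. incl m ((M * N) $$ (i, k)) * fls_X ^ k) = y * z * fls_X ^ i" if "i < m" for i
  proof -
    have "(\<Sum>k<m. incl m ((M * N) $$ (i, k)) * fls_X ^ k) =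
        (\<Sum>k<m. \<Sum>j<m. incl m (M $$ (i, j)) * (incl m (N $$ (j, k)) * fls_X ^ k))"
      using c that by (intro sum.cong refl)
        (simp add: scalar_prod_def incl_sum assms(1) incl.hom_mult sum_distrib_left
          sum_distrib_right mult_ac flip: lessThan_atLeast0)
    also have "\<dots> = (\<Sum>j<m. incl m (M $$ (i, j)) * (z * fls_X ^ j))"
      using assms(3) by (subst sum.swap) (simp add: acts_as_mult_def flip: sum_distrib_left)
    also have "\<dots> = z * (\<Sum>j<m. incl m (M $$ (i, j)) * fls_X ^ j)"
      by (simp add: sum_distrib_left mult_ac)
    also have "\<dots> = y * z * fls_X ^ i"
      using assms(2) that by (simp add: acts_as_mult_def mult_ac)
    finally show ?thesis .
  qed
  then show ?thesis using c by (simp add: acts_as_mult_def)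
qed

lemma acts_as_mult_alpha_gen: "m > 0 \<Longrightarrow> acts_as_mult m (alpha_gen m) fls_X"
proof -
  assume m: "m > 0"
  have 1: "incl m (if b then 1 else 0) = (if b then 1 else 0)"
    "incl m (if b then fls_X else 0) = (if b then fls_X ^ m else 0)" for b
    using m incl_X[of m] by (simp_all add: incl_def)
  have "(\<Sum>j<m. incl m (alpha_gen m $$ (i, j)) * fls_X ^ j) = fls_X * fls_X ^ i" if "i < m" for i
  proof (cases "i + 1 < m")
    case True
    then show ?thesis by (simp add: alpha_gen_def 1 mult_delta_left)
  next
    case False
    then have "(\<Sum>j<m. incl m (alpha_gen m $$ (i, j)) * fls_X ^ j) = fls_X ^ m"
      using m that by (simp add: alpha_gen_def 1 mult_delta_left)
    moreover have "m = Suc i" using False that by simp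
    ultimately show ?thesis by simp
  qed
  then show ?thesis by (simp add: acts_as_mult_def alpha_gen_def)
qed

lemma acts_as_mult_power:
  assumes "m > 0" "acts_as_mult m M y"
  shows "acts_as_mult m (M ^\<^sub>m l) (y ^ l)"
proof (induction l)
  case 0
  have "dim_row M = m" using assms by (auto simp: acts_as_mult_def)
  then show ?case using acts_as_mult_one[OF assms(1)] by simp
next
  case (Suc l)
  then show ?case using acts_as_mult_mult[OF assms(1) Suc assms(2)] by (simp add: mult.commute)
qed

text \<open>The relation passes from the generator to its powers and to their combinations over the
  smaller field. Together with uniqueness and multiplicativity of the relation, this makes \<open>\<alpha>\<close>
  multiplicative.\<close>

lemma acts_as_mult_alpha:
  assumes m: "m > 0"
  shows "acts_as_mult m (alpha m x) x"
proof -
  interpret incl: comm_ring_hom "incl m" by (rule incl_ring_hom[OF m])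
  have "(\<Sum>j<m. incl m (alpha m x $$ (i, j)) * fls_X ^ j) = x * fls_X ^ i" if "i < m" for i
  proof -
    have "(\<Sum>j<m. incl m (alpha m x $$ (i, j)) * fls_X ^ j) =
       (\<Sum>j<m. \<Sum>l<m. incl m (component m l x) * (incl m ((alpha_gen m ^\<^sub>m l) $$ (i, j)) * fls_X ^ j))"
      using that by (intro sum.cong refl)
        (simp add: alpha_def incl_sum[OF m] incl.hom_mult sum_distrib_right sum_distrib_left mult_ac)
    also have "\<dots> = (\<Sum>l<m. incl m (component m l x) * (fls_X ^ l * fls_X ^ i))"
      using acts_as_mult_power[OF m acts_as_mult_alpha_gen[OF m]] that
      by (subst sum.swap) (simp add: acts_as_mult_def flip: sum_distrib_left)
    also have "\<dots> = x * fls_X ^ i"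
      by (subst (2) component_expansion[OF m, of x]) (simp add: sum_distrib_right sum_distrib_left mult_ac)
    finally show ?thesis .
  qed
  then show ?thesis by (simp add: acts_as_mult_def alpha_def)
qed

section \<open>Matrices commuting with alpha up to a root of unity\<close>

text \<open>
  The heart of the argument. Let \<open>L\<close> be the linear map with \<open>L(\<epsilon>\<^bsup>i/m\<^esup>) = w\<^sub>i\<close>, the combination of
  the basis given by row \<open>i\<close> of \<open>M\<close>. The hypothesis says \<open>L(x y) = c x L(y)\<close>. Expanding \<open>L\<close> in the
  powers of the automorphism, genericity of \<open>x\<^sup>n\<close> leaves only the zeroth one.
\<close>

lemma twisted_commutant:
  assumes m: "m > 0" and n: "n > 0" and gen: "generic m (x ^ n)" and c: "c ^ n = 1"
    and A: "acts_as_mult m A x" and M: "M \<in> carrier_mat m m"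
    and comm: "fls_const c \<cdot>\<^sub>m (M * A) = A * M"
  obtains e where "acts_as_mult m M e" "c \<noteq> 1 \<Longrightarrow> x \<noteq> 0 \<Longrightarrow> e = 0"
proof -
  interpret incl: comm_ring_hom "incl m" by (rule incl_ring_hom[OF m])
  define w where "w i = (\<Sum>k<m. incl m (M $$ (i, k)) * fls_X ^ k)" for i
  define z where "z = fls_const (zeta m)"
  have z: "z ^ m = 1" "\<And>l. 0 < l \<Longrightarrow> l < m \<Longrightarrow> z ^ l \<noteq> 1"
    using m zeta_power_neq_1[of _ m] by (simp_all add: z_def fls_const_power[symmetric] fls_const_eq_1)
  have Ac: "A \<in> carrier_mat m m" using A by (simp add: acts_as_mult_def)
  have incl_c: "incl m (fls_const c) = fls_const c" using m by (simp add: incl_def)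
  \<comment> \<open>The left side is \<open>L(x \<epsilon>\<^bsup>i/m\<^esup>)\<close>.\<close>
  have eig: "(\<Sum>l<m. incl m (A $$ (i, l)) * w l) = fls_const c * x * w i" if i: "i < m" for i
  proof -
    have "(\<Sum>l<m. incl m (A $$ (i, l)) * w l) = (\<Sum>k<m. incl m ((A * M) $$ (i, k)) * fls_X ^ k)"
      unfolding w_def sum_distrib_left using i Ac M
      by (subst sum.swap) (simp add: scalar_prod_def incl_sum[OF m] incl.hom_mult
          sum_distrib_left sum_distrib_right mult_ac flip: lessThan_atLeast0)
    also have "\<dots> = fls_const c * (\<Sum>k<m. \<Sum>l<m. incl m (M $$ (i, l)) * (incl m (A $$ (l, k)) * fls_X ^ k))"
      unfolding comm [symmetric] using i Ac M m
      by (simp add: scalar_prod_def incl_sum[OF m] incl.hom_mult sum_distrib_left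
          sum_distrib_right mult_ac incl_c flip: lessThan_atLeast0)
    also have "\<dots> = fls_const c * (\<Sum>l<m. incl m (M $$ (i, l)) * (x * fls_X ^ l))"
      using A by (subst sum.swap) (simp add: acts_as_mult_def flip: sum_distrib_left)
    also have "\<dots> = fls_const c * x * w i"
      by (simp add: w_def sum_distrib_left mult_ac)
    finally show ?thesis .
  qed
  \<comment> \<open>Dividing by the basis element turns the values of the conjugations into pure powers of the root
    of unity, so that the coefficients of \<open>L\<close> come from Fourier inversion.\<close>
  obtain d where d: "\<And>i. i < m \<Longrightarrow> w i / fls_X ^ i = (\<Sum>j<m. d j * z ^ (i * j))"
    using fourier_synthesis_exists[OF z, of "\<lambda>i. w i / fls_X ^ i"] by blast
  have conj: "(sigma m ^^ j) (fls_X ^ i) = z ^ (i * j) * fls_X ^ i" for i j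
    by (simp add: sigma_funpow_power sigma_funpow_X power_mult_distrib z_def fls_const_power[symmetric]
        mult.commute flip: power_mult)
  have w: "w i = (\<Sum>j<m. d j * (sigma m ^^ j) (fls_X ^ i))" if "i < m" for i
  proof -
    have "(fls_X :: laurent) ^ i \<noteq> 0" by simp
    then have "w i = (\<Sum>j<m. d j * z ^ (i * j)) * fls_X ^ i"
      using d[OF that] by (metis nonzero_divide_eq_eq)
    then show ?thesis by (simp add: conj sum_distrib_left sum_distrib_right mult_ac)
  qed
  have "d j * ((sigma m ^^ j) x - fls_const c * x) = 0" if j: "j < m" for j
  proof (rule fourier_coefficients_unique[OF z _ j])
    fix i assume i: "i < m"
    have "(\<Sum>l<m. incl m (A $$ (i, l)) * w l) =
        (\<Sum>j<m. d j * (sigma m ^^ j) (\<Sum>l<m. incl m (A $$ (i, l)) * fls_X ^ l))"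
      by (simp add: w sigma_funpow_sum sigma_funpow_mult sigma_funpow_incl[OF m] sum_distrib_left)
         (subst sum.swap, simp add: mult_ac)
    also have "\<dots> = (\<Sum>j<m. d j * (sigma m ^^ j) x * (sigma m ^^ j) (fls_X ^ i))"
      using A i by (simp add: acts_as_mult_def sigma_funpow_mult mult_ac)
    finally have "(\<Sum>j<m. d j * ((sigma m ^^ j) x - fls_const c * x) * (sigma m ^^ j) (fls_X ^ i)) = 0"
      using eig[OF i] by (simp add: w[OF i] sum_distrib_left algebra_simps sum_subtractf)
    then have "(\<Sum>j<m. d j * ((sigma m ^^ j) x - fls_const c * x) * z ^ (i * j)) * fls_X ^ i = 0"
      unfolding sum_distrib_right by (simp add: conj mult_ac)
    then show "(\<Sum>j<m. d j * ((sigma m ^^ j) x - fls_const c * x) * z ^ (i * j)) = 0"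
      by simp
  qed
  then have coeff: "d j = 0 \<or> (sigma m ^^ j) x = fls_const c * x" if "j < m" for j
    using that by auto
  have "d j = 0" if "0 < j" "j < m" for j
  proof (rule ccontr)
    assume "d j \<noteq> 0"
    \<comment> \<open>Taking \<open>n\<close>-th powers makes the twist disappear.\<close>
    then have "(sigma m ^^ j) (x ^ n) = (fls_const c * x) ^ n"
      using coeff[OF that(2)] by (simp add: sigma_funpow_power)
    also have "\<dots> = x ^ n" using c by (simp add: power_mult_distrib fls_const_power[symmetric])
    finally show False using generic_conjugate_neq[OF gen that] by simp
  qed
  then have "w i = (\<Sum>j<m. if j = 0 then d 0 * fls_X ^ i else 0)" if "i < m" for i
    unfolding w[OF that] by (intro sum.cong) auto
  then have "acts_as_mult m M (d 0)"
    using M m by (simp add: acts_as_mult_def w_def)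
  moreover have "d 0 = 0" if "c \<noteq> 1" "x \<noteq> 0"
  proof -
    show ?thesis using coeff[OF m] that by (auto simp: fls_const_eq_1)
  qed
  ultimately show ?thesis by (rule that)
qed

section \<open>Endomorphisms of the representation\<close>

text \<open>The identity block forces the second component of a morphism to be the conjugate of the
  first one.\<close>

lemma rep_hom_identity:
  assumes "A \<in> carrier_mat m m"
  shows "rep_hom n (rep_of n A (1\<^sub>m m)) (rep_of n A (1\<^sub>m m)) =
    {(P, map_mat (sigma_inv n) P) | P. P \<in> carrier_mat m m \<and> map_mat (sigma_inv n) P * A = A * P}"
    (is "?L = ?R")
proof -
  have d: "dimension_vector (rep_of n A (1\<^sub>m m)) = (m, m)"
    using assms by (simp add: rep_of_def)
  show ?thesis
    using rep_matrix_rep_of[OF assms one_carrier_mat, of n]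
    by (auto simp: rep_hom_def d)
qed

lemma is_representation_rep_of:
  assumes A: "A \<in> carrier_mat p p'" and B: "B \<in> carrier_mat p p'"
  shows "is_representation n (rep_of n A B)"
proof -
  have add: "map_vec (sigma_inv n) (w + w') = map_vec (sigma_inv n) w + map_vec (sigma_inv n) w'"
    if "w \<in> carrier_vec p'" "w' \<in> carrier_vec p'" for w w'
    using that by (intro eq_vecI) (auto simp: sigma_inv_add)
  have smult: "map_vec (sigma_inv n) (sigma n c \<cdot>\<^sub>v w) = c \<cdot>\<^sub>v map_vec (sigma_inv n) w" for c w
    by (intro eq_vecI) (auto simp: sigma_inv_mult)
  have dims: "dim_row A = p" "dim_col A = p'" using A by auto
  show ?thesis
    unfolding rep_of_def is_representation.simps dims
  proof (intro conjI ballI allI)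
    fix v w v' w' :: "laurent vec" and c
    assume v: "v \<in> carrier_vec p'" and w: "w \<in> carrier_vec p'"
    have W: "map_vec (sigma_inv n) w \<in> carrier_vec p'" using w by simp
    show "A *\<^sub>v v + B *\<^sub>v map_vec (sigma_inv n) w \<in> carrier_vec p"
      using A B v W by simp
    show "A *\<^sub>v (c \<cdot>\<^sub>v v) + B *\<^sub>v map_vec (sigma_inv n) (sigma n c \<cdot>\<^sub>v w) =
        c \<cdot>\<^sub>v (A *\<^sub>v v + B *\<^sub>v map_vec (sigma_inv n) w)"
      using A B v W
      by (simp add: smult mult_mat_vec[OF A v] mult_mat_vec[OF B W] smult_add_distrib_vec[of _ p])
    assume v': "v' \<in> carrier_vec p'" and w': "w' \<in> carrier_vec p'"
    have W': "map_vec (sigma_inv n) w' \<in> carrier_vec p'" using w' by simp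
    note c = mult_mat_vec_carrier[OF A v] mult_mat_vec_carrier[OF A v']
      mult_mat_vec_carrier[OF B W] mult_mat_vec_carrier[OF B W']
    show "A *\<^sub>v (v + v') + B *\<^sub>v map_vec (sigma_inv n) (w + w') =
        A *\<^sub>v v + B *\<^sub>v map_vec (sigma_inv n) w + (A *\<^sub>v v' + B *\<^sub>v map_vec (sigma_inv n) w')"
      using c by (intro eq_vecI)
       (auto simp: add[OF w w'] mult_add_distrib_mat_vec[OF A v v'] mult_add_distrib_mat_vec[OF B W W'])
  qed
qed

text \<open>
  The solutions \<open>P\<close> of \<open>\<sigma>\<^sub>n\<^sup>-\<^sup>1(P) A = A P\<close> always form an algebra over \<open>k\<close>, as \<open>\<sigma>\<^sub>n\<^sup>-\<^sup>1\<close> is a ring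
  automorphism fixing \<open>k\<close>. It remains to be seen that the matrix inverse of a solution is a solution;
  this follows on multiplying the condition by the inverses from both sides.
\<close>

lemma regular_simple_rep_of_identity:
  assumes n: "n > 0" and m: "m > 0" and A: "A \<in> carrier_mat m m"
    and inv: "\<And>P. P \<in> carrier_mat m m \<Longrightarrow> P \<noteq> 0\<^sub>m m m \<Longrightarrow>
      map_mat (sigma_inv n) P * A = A * P \<Longrightarrow>
      \<exists>P' \<in> carrier_mat m m. P * P' = 1\<^sub>m m \<and> P' * P = 1\<^sub>m m"
  shows "regular_simple n (rep_of n A (1\<^sub>m m))"
proof -
  interpret incl: comm_ring_hom "incl n" by (rule incl_ring_hom[OF n])
  let ?M = "rep_of n A (1\<^sub>m m)" and ?s = "map_mat (sigma_inv n)"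
  define E where "E = endomorphism_algebra n ?M"
  have dim: "dimension_vector ?M = (m, m)" using A by (simp add: rep_of_def)
  have carr: "carrier E = {(P, ?s P) | P. P \<in> carrier_mat m m \<and> ?s P * A = A * P}"
    by (simp add: E_def endomorphism_algebra_def dim rep_hom_identity[OF A])
  have ops: "\<zero>\<^bsub>E\<^esub> = (0\<^sub>m m m, 0\<^sub>m m m)" "\<one>\<^bsub>E\<^esub> = (1\<^sub>m m, 1\<^sub>m m)"
    "(P, Q) \<otimes>\<^bsub>E\<^esub> (P', Q') = (P * P', Q * Q')" "(P, Q) \<oplus>\<^bsub>E\<^esub> (P', Q') = (P + P', Q + Q')"
    "c \<odot>\<^bsub>E\<^esub> (P, Q) = (incl n c \<cdot>\<^sub>m P, incl n c \<cdot>\<^sub>m Q)" for P Q P' Q' c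
    by (simp_all add: E_def endomorphism_algebra_def dim)
  have s_zero: "?s (0\<^sub>m m m) = 0\<^sub>m m m" by (rule eq_matI) auto
  have s_one: "?s (1\<^sub>m m) = 1\<^sub>m m" by (rule sigma_inv.mat_hom_one)
  have s_add: "?s (P + P') = ?s P + ?s P'" if "P \<in> carrier_mat m m" "P' \<in> carrier_mat m m" for P P'
    using that by (intro eq_matI) (auto simp: sigma_inv_add)
  have s_smult: "?s (incl n c \<cdot>\<^sub>m P) = incl n c \<cdot>\<^sub>m ?s P" for c P
    by (intro eq_matI) (auto simp: sigma_inv_mult sigma_inv_incl[OF n])
  have s_mult: "?s (P * P') = ?s P * ?s P'" if "P \<in> carrier_mat m m" "P' \<in> carrier_mat m m" for P P'
    using that by (rule sigma_inv.mat_hom_mult)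
  have EI: "(P, Q) \<in> carrier E" if "P \<in> carrier_mat m m" "?s P * A = A * P" "Q = ?s P" for P Q
    using that by (simp add: carr)
  have EE: "\<exists>P. z = (P, ?s P) \<and> P \<in> carrier_mat m m \<and> ?s P \<in> carrier_mat m m \<and> ?s P * A = A * P"
    if "z \<in> carrier E" for z
    using that by (auto simp: carr)
  have zero_in: "\<zero>\<^bsub>E\<^esub> \<in> carrier E"
    unfolding ops using A by (intro EI) (auto simp: s_zero)
  have one_in: "\<one>\<^bsub>E\<^esub> \<in> carrier E"
    unfolding ops using A by (intro EI) (auto simp: s_one)
  have add_in: "y \<oplus>\<^bsub>E\<^esub> z \<in> carrier E" if y: "y \<in> carrier E" and z: "z \<in> carrier E" for y z
  proof -
    obtain P where P: "y = (P, ?s P)" "P \<in> carrier_mat m m" "?s P \<in> carrier_mat m m" "?s P * A = A * P"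
      using EE[OF y] by blast
    obtain R where R: "z = (R, ?s R)" "R \<in> carrier_mat m m" "?s R \<in> carrier_mat m m" "?s R * A = A * R"
      using EE[OF z] by blast
    show ?thesis unfolding P(1) R(1) ops
    proof (rule EI)
      show "?s (P + R) * A = A * (P + R)"
        using P R by (simp add: s_add add_mult_distrib_mat[OF _ _ A] mult_add_distrib_mat[OF A])
    qed (use P R in \<open>auto simp: s_add\<close>)
  qed
  have mult_in: "y \<otimes>\<^bsub>E\<^esub> z \<in> carrier E" if y: "y \<in> carrier E" and z: "z \<in> carrier E" for y z
  proof -
    obtain P where P: "y = (P, ?s P)" "P \<in> carrier_mat m m" "?s P \<in> carrier_mat m m" "?s P * A = A * P"
      using EE[OF y] by blast
    obtain R where R: "z = (R, ?s R)" "R \<in> carrier_mat m m" "?s R \<in> carrier_mat m m" "?s R * A = A * R"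
      using EE[OF z] by blast
    show ?thesis unfolding P(1) R(1) ops
    proof (rule EI)
      have "?s (P * R) * A = ?s P * (?s R * A)"
        using P R A by (simp add: s_mult assoc_mult_mat[of _ m m _ m _ m])
      also have "\<dots> = ?s P * A * R"
        unfolding R(4) using P(3) R(2) A by (simp add: assoc_mult_mat[of _ m m _ m _ m])
      also have "\<dots> = A * (P * R)"
        unfolding P(4) using P(2) R(2) A by (simp add: assoc_mult_mat[of _ m m _ m _ m])
      finally show "?s (P * R) * A = A * (P * R)" .
    qed (use P R in \<open>auto simp: s_mult\<close>)
  qed
  have smult_in: "c \<odot>\<^bsub>E\<^esub> z \<in> carrier E" if z: "z \<in> carrier E" for c z
  proof -
    obtain R where R: "z = (R, ?s R)" "R \<in> carrier_mat m m" "?s R \<in> carrier_mat m m" "?s R * A = A * R"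
      using EE[OF z] by blast
    show ?thesis unfolding R(1) ops
    proof (rule EI)
      show "?s (incl n c \<cdot>\<^sub>m R) * A = A * (incl n c \<cdot>\<^sub>m R)"
        using R A by (simp add: s_smult mult_smult_distrib[of _ m m _ m] mult_smult_assoc_mat[of _ m m _ m])
    qed (use R in \<open>auto simp: s_smult\<close>)
  qed
  have group: "abelian_group E"
  proof (rule abelian_groupI)
    show "\<zero>\<^bsub>E\<^esub> \<in> carrier E" by (rule zero_in)
  next
    fix z assume z: "z \<in> carrier E"
    have "incl n (-1) = -1" using n by (simp add: incl_def)
    moreover have "(- 1 :: laurent) \<cdot>\<^sub>m R + R = 0\<^sub>m m m" if "R \<in> carrier_mat m m" for R
      using that by (intro eq_matI) auto
    ultimately have "((-1) \<odot>\<^bsub>E\<^esub> z) \<oplus>\<^bsub>E\<^esub> z = \<zero>\<^bsub>E\<^esub>"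
      using EE[OF z] by (auto simp: ops)
    then show "\<exists>y\<in>carrier E. y \<oplus>\<^bsub>E\<^esub> z = \<zero>\<^bsub>E\<^esub>" using smult_in[OF z] by blast
    fix y assume "y \<in> carrier E"
    then show "z \<oplus>\<^bsub>E\<^esub> y \<in> carrier E" by (rule add_in[OF z])
  qed (auto simp: ops dest!: EE intro!: assoc_add_mat[of _ m m] comm_add_mat[of _ m m])
  have monoid: "monoid E"
  proof (rule monoidI)
    fix y z w assume "y \<in> carrier E" "z \<in> carrier E" "w \<in> carrier E"
    then show "y \<otimes>\<^bsub>E\<^esub> z \<otimes>\<^bsub>E\<^esub> w = y \<otimes>\<^bsub>E\<^esub> (z \<otimes>\<^bsub>E\<^esub> w)"
      by (auto simp: ops dest!: EE intro!: assoc_mult_mat[of _ m m _ m _ m])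
  qed (use mult_in one_in in \<open>auto simp: ops dest!: EE\<close>)
  have ring: "Ring.ring E"
    by (rule ringI[OF group monoid])
      (auto simp: ops dest!: EE intro!: add_mult_distrib_mat[of _ m m _ _ m] mult_add_distrib_mat[of _ m m _ m])
  have field: "Ring.field (class_ring :: laurent ring)" by (rule class_field.field_axioms)
  have module: "Module.module (class_ring :: laurent ring) E"
  proof (rule moduleI)
    show "cring (class_ring :: laurent ring)" using field by (simp add: field_def domain_def)
    fix a b :: laurent and y z
    assume y: "y \<in> carrier E"
    show "a \<odot>\<^bsub>E\<^esub> y \<in> carrier E" by (rule smult_in[OF y])
    have "(incl n a + incl n b) \<cdot>\<^sub>m R = incl n a \<cdot>\<^sub>m R + incl n b \<cdot>\<^sub>m R" for R
      by (rule add_smult_distrib_right_mat[OF carrier_matI[OF refl refl]])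
    then show "(a \<oplus>\<^bsub>class_ring\<^esub> b) \<odot>\<^bsub>E\<^esub> y = a \<odot>\<^bsub>E\<^esub> y \<oplus>\<^bsub>E\<^esub> b \<odot>\<^bsub>E\<^esub> y"
      using EE[OF y] by (auto simp: ops incl.hom_add)
    show "(a \<otimes>\<^bsub>class_ring\<^esub> b) \<odot>\<^bsub>E\<^esub> y = a \<odot>\<^bsub>E\<^esub> (b \<odot>\<^bsub>E\<^esub> y)"
      using EE[OF y] by (auto simp: ops incl.hom_mult mult.assoc intro!: eq_matI)
    show "\<one>\<^bsub>class_ring\<^esub> \<odot>\<^bsub>E\<^esub> y = y"
      using EE[OF y] by (auto simp: ops intro!: eq_matI)
    assume z: "z \<in> carrier E"
    show "a \<odot>\<^bsub>E\<^esub> (y \<oplus>\<^bsub>E\<^esub> z) = a \<odot>\<^bsub>E\<^esub> y \<oplus>\<^bsub>E\<^esub> a \<odot>\<^bsub>E\<^esub> z"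
      using EE[OF y] EE[OF z] by (auto simp: ops intro!: add_smult_distrib_left_mat[of _ m m])
  qed (rule group)
  have bilinear: "(c \<odot>\<^bsub>E\<^esub> y) \<otimes>\<^bsub>E\<^esub> z = c \<odot>\<^bsub>E\<^esub> (y \<otimes>\<^bsub>E\<^esub> z)"
    "y \<otimes>\<^bsub>E\<^esub> (c \<odot>\<^bsub>E\<^esub> z) = c \<odot>\<^bsub>E\<^esub> (y \<otimes>\<^bsub>E\<^esub> z)"
    if "y \<in> carrier E" "z \<in> carrier E" for c y z
    using EE[OF that(1)] EE[OF that(2)]
    by (auto simp: ops intro!: mult_smult_distrib[of _ m m _ m] mult_smult_assoc_mat[of _ m m _ m])
  have "\<zero>\<^bsub>E\<^esub> \<notin> Units E"
  proof
    have "(1\<^sub>m m :: laurent mat) $$ (0, 0) \<noteq> 0\<^sub>m m m $$ (0, 0)" using m by simp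
    then have "(1\<^sub>m m :: laurent mat) \<noteq> 0\<^sub>m m m" by metis
    moreover assume "\<zero>\<^bsub>E\<^esub> \<in> Units E"
    then obtain z where "z \<in> carrier E" "z \<otimes>\<^bsub>E\<^esub> \<zero>\<^bsub>E\<^esub> = \<one>\<^bsub>E\<^esub>"
      by (auto simp: Units_def)
    ultimately show False by (auto simp: ops dest!: EE)
  qed
  moreover have "z \<in> Units E" if z: "z \<in> carrier E" and nz: "z \<noteq> \<zero>\<^bsub>E\<^esub>" for z
  proof -
    obtain P where P: "z = (P, ?s P)" "P \<in> carrier_mat m m" "?s P \<in> carrier_mat m m" "?s P * A = A * P"
      using EE[OF z] by blast
    have "P \<noteq> 0\<^sub>m m m" using nz P(1) by (auto simp: ops s_zero)
    from inv[OF P(2) this P(4)] obtain R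
      where R: "R \<in> carrier_mat m m" "P * R = 1\<^sub>m m" "R * P = 1\<^sub>m m" by blast
    have sR: "?s R \<in> carrier_mat m m" using R by simp
    have PR: "?s P * ?s R = 1\<^sub>m m" "?s R * ?s P = 1\<^sub>m m"
      unfolding s_mult[OF P(2) R(1), symmetric] s_mult[OF R(1) P(2), symmetric] R(2,3)
      by (simp_all add: s_one)
    have "?s R * A = ?s R * (A * P) * R"
      using R(1,2) P(2) sR A by (simp add: assoc_mult_mat[of _ m m _ m _ m])
    also have "\<dots> = (?s R * ?s P) * A * R"
      using R(1) P sR A unfolding P(4) [symmetric] by (simp add: assoc_mult_mat[of _ m m _ m _ m])
    also have "\<dots> = A * R" using A by (simp add: PR)
    finally have "(R, ?s R) \<in> carrier E" using R(1) by (intro EI) auto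
    then show ?thesis
      using z R PR unfolding Units_def P(1) by (auto simp: ops intro!: bexI[of _ "(R, ?s R)"])
  qed
  ultimately have "Units E = carrier E - {\<zero>\<^bsub>E\<^esub>}"
    by (auto simp: Units_def)
  then have "division_algebra (class_ring :: laurent ring) E"
    using field module ring bilinear by (simp add: division_algebra_def)
  then show ?thesis
    using is_representation_rep_of[OF A one_carrier_mat] dim m
    by (auto simp: regular_simple_def E_def intro: exI[of _ m])
qed

text \<open>The coordinate matrices \<open>M l\<close> of \<open>P\<close> commute with \<open>\<alpha>(x)\<close> up to powers of a root of
  unity. For positive \<open>l\<close> the twist is nontrivial and \<open>M l\<close> vanishes, whereas \<open>M 0\<close> is
  multiplication by an element of a field.\<close>

lemma twisted_endomorphism_invertible:
  assumes n: "n > 0" and m: "m > 0" and gen: "generic m (x ^ n)" and x: "x \<noteq> 0"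
    and P: "P \<in> carrier_mat m m" and nz: "P \<noteq> 0\<^sub>m m m"
    and comm: "map_mat (sigma_inv n) P * map_mat (incl n) (alpha m x) =
      map_mat (incl n) (alpha m x) * P"
  shows "\<exists>P' \<in> carrier_mat m m. P * P' = 1\<^sub>m m \<and> P' * P = 1\<^sub>m m"
proof -
  interpret incl: comm_ring_hom "incl n" by (rule incl_ring_hom[OF n])
  define A where "A = alpha m x"
  have A: "acts_as_mult m A x" unfolding A_def by (rule acts_as_mult_alpha[OF m])
  then have Ac: "A \<in> carrier_mat m m" by (simp add: acts_as_mult_def)
  define M where "M l = map_mat (component n l) P" for l
  have M: "M l \<in> carrier_mat m m" for l using P by (simp add: M_def)
  have comm_l: "fls_const (inverse (zeta n ^ l)) \<cdot>\<^sub>m (M l * A) = A * M l" if l: "l < n" for l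
  proof (rule eq_matI)
    fix i k assume "i < dim_row (A * M l)" "k < dim_col (A * M l)"
    then have ik: "i < m" "k < m" using Ac M[of l] by auto
    have "(map_mat (sigma_inv n) P * map_mat (incl n) A) $$ (i, k) =
        (map_mat (incl n) A * P) $$ (i, k)"
      using comm by (simp add: A_def)
    then have "(\<Sum>j<m. incl n (A $$ (j, k)) * sigma_inv n (P $$ (i, j))) =
        (\<Sum>j<m. incl n (A $$ (i, j)) * P $$ (j, k))"
      using ik P Ac by (simp add: scalar_prod_def mult.commute flip: lessThan_atLeast0)
    from arg_cong[OF this, of "component n l"]
    show "(fls_const (inverse (zeta n ^ l)) \<cdot>\<^sub>m (M l * A)) $$ (i, k) = (A * M l) $$ (i, k)"
      using ik P Ac l
      by (simp add: M_def scalar_prod_def component_sum component_incl_mult component_sigma_inv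
          sum_distrib_left mult_ac flip: lessThan_atLeast0)
  qed (use Ac M[of l] in auto)
  have root: "inverse (zeta n ^ l) ^ n = 1" for l
    using n by (metis inverse_1 mult.commute power_inverse power_mult power_one zeta_power)
  have higher: "M l = 0\<^sub>m m m" if l: "0 < l" "l < n" for l
  proof -
    obtain e where e: "acts_as_mult m (M l) e" "inverse (zeta n ^ l) \<noteq> 1 \<Longrightarrow> x \<noteq> 0 \<Longrightarrow> e = 0"
      using twisted_commutant[OF m n gen root A M comm_l[OF l(2)]] by blast
    have "e = 0" using e(2) x zeta_power_neq_1[OF l] by simp
    moreover have "acts_as_mult m (0\<^sub>m m m) 0" by (simp add: acts_as_mult_def incl_def)
    ultimately show ?thesis using acts_as_mult_unique e(1) by blast
  qed
  obtain e where e: "acts_as_mult m (M 0) e"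
    using twisted_commutant[OF m n gen root A M comm_l[OF n]] by blast
  have P_eq: "P = map_mat (incl n) (M 0)"
  proof (rule eq_matI)
    fix i j assume "i < dim_row (map_mat (incl n) (M 0))" "j < dim_col (map_mat (incl n) (M 0))"
    then have ij: "i < m" "j < m" using M[of 0] by auto
    have "component n l (P $$ (i, j)) = (if l = 0 then M 0 $$ (i, j) else 0)" if "l < n" for l
    proof -
      have "component n l (P $$ (i, j)) = M l $$ (i, j)" using P ij by (simp add: M_def)
      then show ?thesis using higher[of l] \<open>l < n\<close> ij by (cases "l = 0") auto
    qed
    then have "P $$ (i, j) = (\<Sum>l<n. incl n (if l = 0 then M 0 $$ (i, j) else 0) * fls_X ^ l)"
      by (subst component_expansion[OF n]) (intro sum.cong, auto)
    also have "\<dots> = (\<Sum>l<n. if l = 0 then incl n (M 0 $$ (i, j)) else 0)"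
      by (intro sum.cong) auto
    also have "\<dots> = incl n (M 0 $$ (i, j))" using n by simp
    finally show "P $$ (i, j) = map_mat (incl n) (M 0) $$ (i, j)" using ij M[of 0] by simp
  qed (use P M[of 0] in auto)
  have "e \<noteq> 0"
  proof
    assume "e = 0"
    moreover have "acts_as_mult m (0\<^sub>m m m) 0" by (simp add: acts_as_mult_def incl_def)
    ultimately have "M 0 = 0\<^sub>m m m" using acts_as_mult_unique e by blast
    moreover have "map_mat (incl n) (0\<^sub>m m m) = 0\<^sub>m m m" by (rule eq_matI) auto
    ultimately show False using nz P_eq by simp
  qed
  \<comment> \<open>The inverse of multiplication by \<open>e\<close> is multiplication by its reciprocal.\<close>
  define R where "R = alpha m (1 / e)"
  have R: "acts_as_mult m R (1 / e)" unfolding R_def by (rule acts_as_mult_alpha[OF m])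
  then have Rc: "R \<in> carrier_mat m m" by (simp add: acts_as_mult_def)
  have MR: "M 0 * R = 1\<^sub>m m" "R * M 0 = 1\<^sub>m m"
    using acts_as_mult_mult[OF m e R] acts_as_mult_mult[OF m R e] acts_as_mult_one[OF m]
      \<open>e \<noteq> 0\<close> acts_as_mult_unique by auto
  have "P * map_mat (incl n) R = 1\<^sub>m m" "map_mat (incl n) R * P = 1\<^sub>m m"
    unfolding P_eq incl.mat_hom_mult[OF M[of 0] Rc, symmetric]
      incl.mat_hom_mult[OF Rc M[of 0], symmetric] MR
    by (simp_all add: incl.mat_hom_one)
  then show ?thesis using Rc by (intro bexI[of _ "map_mat (incl n) R"]) auto
qed

theorem theorem3p23:
  fixes n m :: nat and x :: laurent
  assumes "n > 0" and "m > 0" and "generic m (x ^ n)"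
  shows "regular_simple n (rep_of n (map_mat (incl n) (alpha m x)) (1\<^sub>m m))"
proof (rule regular_simple_rep_of_identity[OF assms(1,2)])
  show "map_mat (incl n) (alpha m x) \<in> carrier_mat m m" by (simp add: alpha_def)
  fix P :: "laurent mat"
  assume P: "P \<in> carrier_mat m m" "P \<noteq> 0\<^sub>m m m"
    "map_mat (sigma_inv n) P * map_mat (incl n) (alpha m x) = map_mat (incl n) (alpha m x) * P"
  show "\<exists>P' \<in> carrier_mat m m. P * P' = 1\<^sub>m m \<and> P' * P = 1\<^sub>m m"
  proof (cases "x = 0")
    case False
    then show ?thesis using twisted_endomorphism_invertible[OF assms False P] by blast
  next
    case True
    \<comment> \<open>The orbit of zero is a singleton, so that genericity leaves only dimension one.\<close>
    have "(sigma m ^^ j) 0 = 0" for j using sigma_funpow_const[of j m 0] by simp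
    then have m: "m = 1" using assms True by (simp add: generic_def power_0_left)
    define p where "p = P $$ (0, 0)"
    have "p \<noteq> 0"
    proof
      assume "p = 0"
      then have "P = 0\<^sub>m m m" using P(1) by (intro eq_matI) (auto simp: m p_def)
      with P(2) show False ..
    qed
    let ?R = "mat 1 1 (\<lambda>_. 1 / p)"
    have "P * ?R = 1\<^sub>m m" "?R * P = 1\<^sub>m m"
      using P(1) \<open>p \<noteq> 0\<close> by (auto intro!: eq_matI simp: m scalar_prod_def p_def)
    then show ?thesis by (intro bexI[of _ ?R]) (auto simp: m)
  qed
qed

end
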